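(* Let $p,q$ be positive integers with $p\leqslant q$ such that it is not the case that ($p<q$, $p$ is odd and $q$ is even). Then there exist a complex Hilbert space $\mathcal{H}$, a selfadjoint operator $T\in \boldsymbol{B}(\mathcal{H})$ and a semispectral measure $F\colon \mathfrak{B}(\mathbb{R}) \to \boldsymbol{B}(\mathcal{H})$ with compact support which is not spectral and such that $$T^k=\int_{\mathbb{R}} x^k F(\mathrm{d} x), \quad k=p,q.$$
   Context: $\boldsymbol{B}(\mathcal{H})$ denotes the algebra of all bounded linear operators on $\mathcal{H}$, $I$ the identity operator on $\mathcal{H}$, and $\mathfrak{B}(\mathbb{R})$ the $\sigma$-algebra of Borel subsets of $\mathbb{R}$. A map $F\colon \mathfrak{B}(\mathbb{R})\to\boldsymbol{B}(\mathcal{H})$ is a semispectral measure if $\langle F(\cdot)h,h\rangle$ is a positive measure for every $h\in\mathcal{H}$ and $F(\mathbb{R})=I$; it is spectral (a spectral measure) if in addition $F(\varDelta)$ is an orthogonal projection for every $\varDelta\in\mathfrak{B}(\mathbb{R})$. "Compact support" refers to the closed support of $F$. For such $F$, $\int_{\mathbb{R}} x^k F(\mathrm{d}x)$ is the unique operator in $\boldsymbol{B}(\mathcal{H})$ such that $\langle \int_{\mathbb{R}} x^k F(\mathrm{d}x)\, h,h\rangle=\int_{\mathbb{R}} x^k\langle F(\mathrm{d}x)h,h\rangle$ for all $h\in\mathcal{H}$. *)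

theory Defs
  imports "HOL-Analysis.Analysis" "HOL-Algebra.Module" "HOL-Algebra.Algebraic_Closure_Type"
begin

text \<open>
  Neither complex inner products nor complex Hilbert spaces exist in the distribution. They are
  carrier-based here, since a statement of the form ``there is a Hilbert space'' cannot quantify
  over types. As always for modules in HOL-Algebra, the fields \<open>mult\<close> and \<open>one\<close> of the record carry
  no information. The inner product is linear in its first argument.
\<close>

record 'a chilbert = "(complex, 'a) module" +
  cip :: "'a \<Rightarrow> 'a \<Rightarrow> complex"

definition hnorm :: "'a chilbert \<Rightarrow> 'a \<Rightarrow> real" where
  "hnorm H x = sqrt (Re (cip H x x))"

definition hdist :: "'a chilbert \<Rightarrow> 'a \<Rightarrow> 'a \<Rightarrow> real" where
  "hdist H x y = hnorm H (x \<ominus>\<^bsub>H\<^esub> y)"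

locale complex_hilbert =
  module "ring_of_type_algebra :: complex ring" H for H :: "'a chilbert" (structure) +
  assumes cip_add_left:
      "\<lbrakk>x \<in> carrier H; y \<in> carrier H; z \<in> carrier H\<rbrakk>
        \<Longrightarrow> cip H (x \<oplus> y) z = cip H x z + cip H y z"
    and cip_smult_left:
      "\<lbrakk>x \<in> carrier H; y \<in> carrier H\<rbrakk> \<Longrightarrow> cip H (a \<odot> x) y = a * cip H x y"
    and cip_commute:
      "\<lbrakk>x \<in> carrier H; y \<in> carrier H\<rbrakk> \<Longrightarrow> cip H x y = cnj (cip H y x)"
    and cip_nonneg: "x \<in> carrier H \<Longrightarrow> cip H x x \<in> \<real>\<^sub>\<ge>\<^sub>0"
    and cip_definite: "\<lbrakk>x \<in> carrier H; cip H x x = 0\<rbrakk> \<Longrightarrow> x = \<zero>"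
    and complete: "Metric_space.mcomplete (carrier H) (hdist H)"

text \<open>
  Operators are extensional (\<open>undefined\<close> off the carrier), so that equality of operators is
  equality of functions.
\<close>

definition bounded_ops :: "'a chilbert \<Rightarrow> ('a \<Rightarrow> 'a) set" where
  "bounded_ops H = {T \<in> carrier H \<rightarrow>\<^sub>E carrier H.
     (\<forall>x\<in>carrier H. \<forall>y\<in>carrier H. T (x \<oplus>\<^bsub>H\<^esub> y) = T x \<oplus>\<^bsub>H\<^esub> T y) \<and>
     (\<forall>a. \<forall>x\<in>carrier H. T (a \<odot>\<^bsub>H\<^esub> x) = a \<odot>\<^bsub>H\<^esub> T x) \<and>
     (\<exists>C. \<forall>x\<in>carrier H. hnorm H (T x) \<le> C * hnorm H x)}"

definition id_op :: "'a chilbert \<Rightarrow> 'a \<Rightarrow> 'a" where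
  "id_op H = (\<lambda>x\<in>carrier H. x)"

definition zero_op :: "'a chilbert \<Rightarrow> 'a \<Rightarrow> 'a" where
  "zero_op H = (\<lambda>x\<in>carrier H. \<zero>\<^bsub>H\<^esub>)"

definition op_power :: "'a chilbert \<Rightarrow> ('a \<Rightarrow> 'a) \<Rightarrow> nat \<Rightarrow> 'a \<Rightarrow> 'a" where
  "op_power H T k = restrict (T ^^ k) (carrier H)"

definition selfadjoint :: "'a chilbert \<Rightarrow> ('a \<Rightarrow> 'a) \<Rightarrow> bool" where
  "selfadjoint H T \<longleftrightarrow> (\<forall>x\<in>carrier H. \<forall>y\<in>carrier H. cip H (T x) y = cip H x (T y))"

definition orthogonal_projection :: "'a chilbert \<Rightarrow> ('a \<Rightarrow> 'a) \<Rightarrow> bool" where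
  "orthogonal_projection H P \<longleftrightarrow>
     P \<in> bounded_ops H \<and> selfadjoint H P \<and> op_power H P 2 = P"

text \<open>
  Operator-valued set functions are total on \<^typ>\<open>real set\<close>; only their values on Borel sets
  matter. The conjunct on \<open>\<real>\<^sub>\<ge>\<^sub>0\<close> ensures that passing to \<^const>\<open>Re\<close> and \<^const>\<open>ennreal\<close> loses nothing.
\<close>

definition semispectral_measure :: "'a chilbert \<Rightarrow> (real set \<Rightarrow> 'a \<Rightarrow> 'a) \<Rightarrow> bool" where
  "semispectral_measure H F \<longleftrightarrow>
     (\<forall>D\<in>sets borel. F D \<in> bounded_ops H) \<and>
     (\<forall>h\<in>carrier H. (\<forall>D\<in>sets borel. cip H (F D h) h \<in> \<real>\<^sub>\<ge>\<^sub>0) \<and>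
        measure_space UNIV (sets borel) (\<lambda>D. ennreal (Re (cip H (F D h) h)))) \<and>
     F UNIV = id_op H"

definition spectral_measure :: "'a chilbert \<Rightarrow> (real set \<Rightarrow> 'a \<Rightarrow> 'a) \<Rightarrow> bool" where
  "spectral_measure H F \<longleftrightarrow>
     semispectral_measure H F \<and> (\<forall>D\<in>sets borel. orthogonal_projection H (F D))"

definition closed_support :: "'a chilbert \<Rightarrow> (real set \<Rightarrow> 'a \<Rightarrow> 'a) \<Rightarrow> real set" where
  "closed_support H F = - \<Union>{U. open U \<and> F U = zero_op H}"

text \<open>The scalar measure \<open>D \<mapsto> \<langle>F(D)h, h\<rangle>\<close>.\<close>

definition scalar_measure ::
    "'a chilbert \<Rightarrow> (real set \<Rightarrow> 'a \<Rightarrow> 'a) \<Rightarrow> 'a \<Rightarrow> real measure" where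
  "scalar_measure H F h = measure_of UNIV (sets borel) (\<lambda>D. ennreal (Re (cip H (F D h) h)))"

text \<open>
  The weak integral. It is meaningful when \<open>f\<close> is integrable for all scalar measures and a bounded
  operator with the stated property exists, as for continuous \<open>f\<close> and a semispectral
  measure \<open>F\<close> with compact support; uniqueness follows by polarization.
\<close>

definition op_integral ::
    "'a chilbert \<Rightarrow> (real set \<Rightarrow> 'a \<Rightarrow> 'a) \<Rightarrow> (real \<Rightarrow> real) \<Rightarrow> 'a \<Rightarrow> 'a" where
  "op_integral H F f = (THE S. S \<in> bounded_ops H \<and>
     (\<forall>h\<in>carrier H. cip H (S h) h = complex_of_real (\<integral>x. f x \<partial>scalar_measure H F h)))"

end

theory Submission
  imports Defs "HOL-Probability.Probability_Measure"
begin

text \<open>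
  On a one-dimensional space every operator is multiplication by a scalar, and a Borel probability
  measure \<open>\<mu>\<close> on the line gives the semispectral measure that sends \<open>D\<close> to multiplication by
  \<open>\<mu> D\<close>. It is spectral only if \<open>\<mu>\<close> takes no value strictly between 0 and 1, and its operator
  integrals are multiplications by the moments of \<open>\<mu>\<close>. The claim thus becomes a scalar
  one (\<open>semispectral_of_moments\<close>): find a real number \<open>t\<close> and a compactly supported probability
  measure, not a point mass, whose moments of orders \<open>p\<close> and \<open>q\<close> are \<open>t ^ p\<close> and \<open>t ^ q\<close>.

  Signs make this possible (\<open>three_point_moments\<close>). If \<open>p\<close> and \<open>q\<close> have the same parity, the
  symmetric measure on \<open>{-1, 1}\<close> works: its odd moments are those of \<open>t = 0\<close> and its even moments
  are those of \<open>t = 1\<close>. If \<open>p\<close> is even and \<open>q > p\<close> is odd, take \<open>t = 1\<close>. The convexity inequality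
  between the moments of orders \<open>p\<close> and \<open>q\<close> bounds only absolute moments, and an atom at \<open>-1\<close>
  lowers the odd moment while it raises the even one; an atom at \<open>2\<close> and an atom at \<open>0\<close> supply the
  remaining mass. In the excluded case, \<open>p < q\<close> with \<open>p\<close> odd and \<open>q\<close> even, cancellation can only
  shrink the moment of order \<open>p\<close>, which is on the small side of the convexity inequality already.
\<close>

section \<open>The line as a Hilbert space of constant sequences\<close>

text \<open>
  Addition reads only the zeroth entries. On constant sequences this is pointwise addition, and it
  gives every sequence, constant or not, exactly one constant sequence as its additive inverse.
  So \<^const>\<open>hdist\<close> is symmetric on the whole type, as \<^locale>\<open>Metric_space\<close> demands.
\<close>

definition const_space :: "(nat \<Rightarrow> complex) chilbert" where
  "const_space = \<lparr>carrier = range (\<lambda>c _. c), mult = (\<lambda>f g. f), one = (\<lambda>_. 0),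
     zero = (\<lambda>_. 0), add = (\<lambda>f g _. f 0 + g 0), smult = (\<lambda>a f i. a * f i),
     cip = (\<lambda>f g. f 0 * cnj (g 0))\<rparr>"

lemma const_space_simps [simp]:
  "carrier const_space = range (\<lambda>c _. c)"
  "\<zero>\<^bsub>const_space\<^esub> = (\<lambda>_. 0)"
  "f \<oplus>\<^bsub>const_space\<^esub> g = (\<lambda>_. f 0 + g 0)"
  "a \<odot>\<^bsub>const_space\<^esub> f = (\<lambda>i. a * f i)"
  "cip const_space f g = f 0 * cnj (g 0)"
  by (simp_all add: const_space_def)

lemma hnorm_const_space [simp]: "hnorm const_space f = norm (f 0)"
  by (simp add: hnorm_def complex_mult_cnj cmod_def)

lemma abelian_group_const_space: "abelian_group const_space"
proof (rule abelian_groupI)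
  fix x assume "x \<in> carrier const_space"
  then show "\<exists>y\<in>carrier const_space. y \<oplus>\<^bsub>const_space\<^esub> x = \<zero>\<^bsub>const_space\<^esub>"
    by (intro bexI[of _ "\<lambda>i. - x i"]) auto
qed (auto simp: algebra_simps)

lemma hdist_const_space [simp]: "hdist const_space x y = dist (x 0) (y 0)"
proof -
  have "\<ominus>\<^bsub>const_space\<^esub> y = (\<lambda>_. - y 0)"
    unfolding a_inv_def m_inv_def
    by (rule the_equality) (auto simp: fun_eq_iff eq_neg_iff_add_eq_0 add.commute)
  then show ?thesis
    by (simp add: hdist_def a_minus_def dist_norm)
qed

lemma mcomplete_const_space: "Metric_space.mcomplete (carrier const_space) (hdist const_space)"
proof -
  interpret M: Metric_space "carrier const_space" "hdist const_space"
    by unfold_locales (auto simp: dist_commute dist_triangle fun_eq_iff)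
  show ?thesis
    unfolding M.mcomplete_def
  proof (intro allI impI)
    fix \<sigma> assume \<sigma>: "M.MCauchy \<sigma>"
    have in_carrier: "\<sigma> n \<in> carrier const_space" for n
      using \<sigma> unfolding M.MCauchy_def by blast
    then have "Cauchy (\<lambda>n. \<sigma> n 0)"
      using \<sigma> unfolding M.MCauchy_def Cauchy_def by (metis hdist_const_space)
    then obtain c where c: "(\<lambda>n. \<sigma> n 0) \<longlonglongrightarrow> c"
      by (auto simp: Cauchy_convergent_iff convergent_def)
    have "limitin M.mtopology \<sigma> (\<lambda>_. c) sequentially"
      unfolding M.limitin_metric
    proof (intro conjI allI impI)
      fix e :: real assume "e > 0"
      with c have "\<forall>\<^sub>F n in sequentially. dist (\<sigma> n 0) c < e"
        by (rule tendstoD)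
      then show "\<forall>\<^sub>F n in sequentially. \<sigma> n \<in> carrier const_space \<and> hdist const_space (\<sigma> n) (\<lambda>_. c) < e"
        by eventually_elim (use in_carrier in auto)
    qed auto
    then show "\<exists>x. limitin M.mtopology \<sigma> x sequentially"
      by blast
  qed
qed

lemma complex_hilbert_const_space: "complex_hilbert const_space"
proof -
  have "module (ring_of_type_algebra :: complex ring) const_space"
  proof (rule moduleI)
    show "cring (ring_of_type_algebra :: complex ring)"
      by (rule cring_from_type_algebra)
    show "abelian_group const_space"
      by (rule abelian_group_const_space)
  qed (auto simp: ring_of_type_algebra_def algebra_simps)
  then show ?thesis
  proof (rule complex_hilbert.intro, unfold_locales)
    fix x
    have "cip const_space x x = complex_of_real ((norm (x 0))\<^sup>2)"
      by (simp only: const_space_simps complex_norm_square)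
    then show "cip const_space x x \<in> \<real>\<^sub>\<ge>\<^sub>0"
      by simp
    show "Metric_space.mcomplete (carrier const_space) (hdist const_space)"
      by (rule mcomplete_const_space)
  qed (auto simp: algebra_simps)
qed

section \<open>Scalar operators\<close>

definition scalar_op :: "complex \<Rightarrow> (nat \<Rightarrow> complex) \<Rightarrow> nat \<Rightarrow> complex" where
  "scalar_op s = (\<lambda>x\<in>carrier const_space. (\<lambda>i. s * x i))"

lemma scalar_op_apply [simp]:
  "scalar_op s (\<lambda>_. c) = (\<lambda>_. s * c)"
  by (simp add: scalar_op_def)

lemma scalar_op_eq_iff [simp]: "scalar_op s = scalar_op r \<longleftrightarrow> s = r"
proof
  assume "scalar_op s = scalar_op r"
  then have "scalar_op s (\<lambda>_. 1) 0 = scalar_op r (\<lambda>_. 1) 0" by simp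
  then show "s = r" by simp
qed simp

lemma bounded_ops_scalar_op: "scalar_op s \<in> bounded_ops const_space"
  unfolding bounded_ops_def
  by (auto simp: scalar_op_def algebra_simps norm_mult intro!: exI[of _ "norm s"])

lemma id_op_const_space: "id_op const_space = scalar_op 1"
  by (auto simp: id_op_def scalar_op_def)

lemma zero_op_const_space: "zero_op const_space = scalar_op 0"
  by (auto simp: zero_op_def scalar_op_def)

lemma selfadjoint_scalar_op: "selfadjoint const_space (scalar_op (complex_of_real s))"
  by (auto simp: selfadjoint_def)

lemma op_power_scalar_op: "op_power const_space (scalar_op s) k = scalar_op (s ^ k)"
proof
  have pow: "(scalar_op s ^^ k) (\<lambda>_. c) = (\<lambda>_. s ^ k * c)" for c
    by (induction k) (auto simp: algebra_simps)
  fix x show "op_power const_space (scalar_op s) k x = scalar_op (s ^ k) x"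
    by (cases "x \<in> carrier const_space") (auto simp: op_power_def pow, simp add: scalar_op_def)
qed

text \<open>In dimension one the value of a quadratic form at a unit vector determines the operator.\<close>

lemma scalar_op_unique:
  assumes S: "S \<in> bounded_ops const_space"
    and quad: "cip const_space (S (\<lambda>_. 1)) (\<lambda>_. 1) = s"
  shows "S = scalar_op s"
proof
  fix x show "S x = scalar_op s x"
  proof (cases "x \<in> carrier const_space")
    case True
    then obtain c where x: "x = (\<lambda>_. c)" by auto
    have "(\<lambda>_. 1) \<in> carrier const_space" by simp
    then have "S (c \<odot>\<^bsub>const_space\<^esub> (\<lambda>_. 1)) = c \<odot>\<^bsub>const_space\<^esub> S (\<lambda>_. 1)"
      using S x True unfolding bounded_ops_def by blast
    then have hom: "S (\<lambda>_. c) = (\<lambda>i. c * S (\<lambda>_. 1) i)"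
      by simp
    have "S (\<lambda>_. 1) \<in> carrier const_space"
      using S by (auto simp: bounded_ops_def)
    with quad have "S (\<lambda>_. 1) = (\<lambda>_. s)" by auto
    with hom x show ?thesis by (simp add: mult.commute)
  next
    case False
    with S show ?thesis by (auto simp: bounded_ops_def scalar_op_def PiE_def extensional_def)
  qed
qed

section \<open>The semispectral measure of a probability measure\<close>

definition scalar_semispectral :: "real measure \<Rightarrow> real set \<Rightarrow> (nat \<Rightarrow> complex) \<Rightarrow> nat \<Rightarrow> complex" where
  "scalar_semispectral \<mu> D = scalar_op (complex_of_real (measure \<mu> D))"

context
  fixes \<mu> :: "real measure"
  assumes prob: "prob_space \<mu>" and sets_borel: "sets \<mu> = sets borel"
begin

interpretation prob_space \<mu> by (rule prob)

lemma cip_scalar_semispectral: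
  assumes "h \<in> carrier const_space"
  shows "cip const_space (scalar_semispectral \<mu> D h) h =
    complex_of_real (measure \<mu> D * (norm (h 0))\<^sup>2)"
  using assms by (auto simp: scalar_semispectral_def mult.assoc simp flip: complex_norm_square)

lemma emeasure_scalar_semispectral:
  assumes "h \<in> carrier const_space" "D \<in> sets borel"
  shows "ennreal (Re (cip const_space (scalar_semispectral \<mu> D h) h)) =
    emeasure (density \<mu> (\<lambda>_. ennreal ((norm (h 0))\<^sup>2))) D"
  using assms sets_borel unfolding cip_scalar_semispectral[OF assms(1)]
  by (simp add: emeasure_density_const emeasure_eq_measure ennreal_mult mult.commute)

lemma scalar_measure_scalar_semispectral:
  assumes "h \<in> carrier const_space"
  shows "scalar_measure const_space (scalar_semispectral \<mu>) h =
    density \<mu> (\<lambda>_. ennreal ((norm (h 0))\<^sup>2))" (is "_ = ?N")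
proof -
  have "space ?N = UNIV" "sets ?N = sets borel"
    using sets_borel sets_eq_imp_space_eq[OF sets_borel] by auto
  then have "?N = measure_of UNIV (sets borel) (emeasure ?N)"
    using measure_of_of_measure[of ?N] by simp
  also have "\<dots> = scalar_measure const_space (scalar_semispectral \<mu>) h"
    unfolding scalar_measure_def
  proof (rule measure_of_eq)
    fix D assume "D \<in> sigma_sets UNIV (sets (borel :: real measure))"
    then have "D \<in> sets borel"
      using sets.sigma_sets_eq[of "borel :: real measure"] by simp
    then show "emeasure ?N D = ennreal (Re (cip const_space (scalar_semispectral \<mu> D h) h))"
      using emeasure_scalar_semispectral[OF assms] by simp
  qed simp
  finally show ?thesis ..
qed

lemma semispectral_measure_scalar_semispectral:
  "semispectral_measure const_space (scalar_semispectral \<mu>)"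
  unfolding semispectral_measure_def
proof (intro conjI ballI)
  fix D
  show "scalar_semispectral \<mu> D \<in> bounded_ops const_space"
    by (simp add: scalar_semispectral_def bounded_ops_scalar_op)
next
  fix h D assume "h \<in> carrier const_space"
  then show "cip const_space (scalar_semispectral \<mu> D h) h \<in> \<real>\<^sub>\<ge>\<^sub>0"
    by (simp only: cip_scalar_semispectral) simp
next
  fix h assume h: "h \<in> carrier const_space"
  let ?N = "density \<mu> (\<lambda>_. ennreal ((norm (h 0))\<^sup>2))"
  have "measure_space UNIV (sets borel) (emeasure ?N)"
    using measure_space[of ?N] sets_borel sets_eq_imp_space_eq[OF sets_borel] by simp
  then show "measure_space UNIV (sets borel)
      (\<lambda>D. ennreal (Re (cip const_space (scalar_semispectral \<mu> D h) h)))"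
    using measure_space_eq[of "sets (borel :: real measure)" UNIV "emeasure ?N"
        "\<lambda>D. ennreal (Re (cip const_space (scalar_semispectral \<mu> D h) h))"]
        emeasure_scalar_semispectral[OF h] sets.sigma_sets_eq[of "borel :: real measure"]
    by (simp del: const_space_simps)
next
  show "scalar_semispectral \<mu> UNIV = id_op const_space"
    using prob_space sets_eq_imp_space_eq[OF sets_borel]
    by (simp add: scalar_semispectral_def id_op_const_space)
qed

lemma not_spectral_scalar_semispectral:
  assumes D: "D \<in> sets borel" "0 < measure \<mu> D" "measure \<mu> D < 1"
  shows "\<not> spectral_measure const_space (scalar_semispectral \<mu>)"
proof
  assume "spectral_measure const_space (scalar_semispectral \<mu>)"
  with D(1) have "op_power const_space (scalar_semispectral \<mu> D) 2 = scalar_semispectral \<mu> D"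
    by (auto simp: spectral_measure_def orthogonal_projection_def)
  then have "(measure \<mu> D)\<^sup>2 = measure \<mu> D"
    by (simp add: scalar_semispectral_def op_power_scalar_op flip: of_real_power)
  with D show False
    by (simp add: power2_eq_square)
qed

lemma compact_closed_support_scalar_semispectral:
  assumes "compact K" "measure \<mu> (- K) = 0"
  shows "compact (closed_support const_space (scalar_semispectral \<mu>))"
proof -
  let ?S = "closed_support const_space (scalar_semispectral \<mu>)"
  have "open (- K)"
    using assms(1) by (simp add: compact_imp_closed open_Compl)
  with assms(2) have "?S \<subseteq> K"
    by (auto simp: closed_support_def zero_op_const_space scalar_semispectral_def)
  moreover have "closed ?S"
    by (auto simp: closed_support_def)
  ultimately show ?thesis
    using assms(1) closed_subset compact_Int_closed by (metis inf.absorb2)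
qed

lemma op_integral_scalar_semispectral:
  assumes f: "f \<in> borel_measurable borel"
  shows "op_integral const_space (scalar_semispectral \<mu>) f =
    scalar_op (complex_of_real (\<integral>x. f x \<partial>\<mu>))"
proof -
  have [measurable]: "f \<in> borel_measurable \<mu>"
    using f sets_borel measurable_cong_sets by blast
  have int: "(\<integral>x. f x \<partial>scalar_measure const_space (scalar_semispectral \<mu>) h) =
      (\<integral>x. f x \<partial>\<mu>) * (norm (h 0))\<^sup>2" if "h \<in> carrier const_space" for h
    using that by (simp add: scalar_measure_scalar_semispectral integral_density)
  show ?thesis
    unfolding op_integral_def
  proof (rule the_equality, intro conjI ballI)
    show "scalar_op (complex_of_real (\<integral>x. f x \<partial>\<mu>)) \<in> bounded_ops const_space"
      by (rule bounded_ops_scalar_op)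
  next
    fix h assume h: "h \<in> carrier const_space"
    show "cip const_space (scalar_op (complex_of_real (\<integral>x. f x \<partial>\<mu>)) h) h =
        complex_of_real (\<integral>x. f x \<partial>scalar_measure const_space (scalar_semispectral \<mu>) h)"
      unfolding int[OF h] using h by (auto simp: mult.assoc simp flip: complex_norm_square)
  next
    fix S assume S: "S \<in> bounded_ops const_space \<and> (\<forall>h\<in>carrier const_space.
      cip const_space (S h) h =
        complex_of_real (\<integral>x. f x \<partial>scalar_measure const_space (scalar_semispectral \<mu>) h))"
    show "S = scalar_op (complex_of_real (\<integral>x. f x \<partial>\<mu>))"
    proof (rule scalar_op_unique)
      have one: "(\<lambda>_. 1) \<in> carrier const_space" by simp
      show "cip const_space (S (\<lambda>_. 1)) (\<lambda>_. 1) = complex_of_real (\<integral>x. f x \<partial>\<mu>)"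
        using S one int[OF one] by (simp del: const_space_simps)
    qed (use S in blast)
  qed
qed

lemma semispectral_of_moments:
  assumes K: "compact K" "measure \<mu> (- K) = 0"
    and D: "D \<in> sets borel" "0 < measure \<mu> D" "measure \<mu> D < 1"
    and moments: "\<And>k. k \<in> A \<Longrightarrow> (\<integral>x. x ^ k \<partial>\<mu>) = t ^ k"
  shows "\<exists>(H :: (nat \<Rightarrow> complex) chilbert) T F.
    complex_hilbert H \<and> T \<in> bounded_ops H \<and> selfadjoint H T \<and>
    semispectral_measure H F \<and> compact (closed_support H F) \<and> \<not> spectral_measure H F \<and>
    (\<forall>k\<in>A. op_power H T k = op_integral H F (\<lambda>x. x ^ k))"
  using complex_hilbert_const_space bounded_ops_scalar_op selfadjoint_scalar_op
    semispectral_measure_scalar_semispectral compact_closed_support_scalar_semispectral[OF K]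
    not_spectral_scalar_semispectral[OF D] moments
  by (intro exI[of _ const_space] exI[of _ "scalar_op (complex_of_real t)"]
      exI[of _ "scalar_semispectral \<mu>"])
    (simp add: op_power_scalar_op op_integral_scalar_semispectral)

end

section \<open>Finitely supported probability measures with prescribed moments\<close>

definition atomic_measure :: "real set \<Rightarrow> (real \<Rightarrow> real) \<Rightarrow> real measure" where
  "atomic_measure S w = distr (point_measure S (\<lambda>x. ennreal (w x))) borel (\<lambda>x. x)"

lemma sets_atomic_measure [simp]: "sets (atomic_measure S w) = sets borel"
  by (simp add: atomic_measure_def)

context
  fixes S :: "real set" and w :: "real \<Rightarrow> real"
  assumes finite: "finite S" and nonneg: "\<And>x. x \<in> S \<Longrightarrow> 0 \<le> w x"
begin

lemma emeasure_atomic_measure: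
  assumes "D \<in> sets borel"
  shows "emeasure (atomic_measure S w) D = ennreal (\<Sum>x\<in>S \<inter> D. w x)"
proof -
  have "emeasure (atomic_measure S w) D = emeasure (point_measure S (\<lambda>x. ennreal (w x))) (S \<inter> D)"
    using assms by (simp add: atomic_measure_def emeasure_distr space_point_measure
        measurable_point_measure_eq1 Int_commute)
  then show ?thesis
    using finite nonneg by (subst sum_ennreal[symmetric]) (auto simp: emeasure_point_measure_finite)
qed

lemma measure_atomic_measure:
  assumes "D \<in> sets borel"
  shows "measure (atomic_measure S w) D = (\<Sum>x\<in>S \<inter> D. w x)"
  using emeasure_atomic_measure[OF assms] nonneg
  by (subst measure_def) (auto intro!: enn2real_ennreal sum_nonneg)

lemma prob_space_atomic_measure: "(\<Sum>x\<in>S. w x) = 1 \<Longrightarrow> prob_space (atomic_measure S w)"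
  using emeasure_atomic_measure[of UNIV]
  by (intro prob_spaceI) (simp add: atomic_measure_def)

lemma integral_atomic_measure:
  assumes [measurable]: "f \<in> borel_measurable borel"
  shows "(\<integral>x. f x \<partial>atomic_measure S w) = (\<Sum>x\<in>S. w x * (f x :: real))"
  unfolding atomic_measure_def
  using finite nonneg
  by (subst integral_distr)
    (auto simp: measurable_point_measure_eq1 lebesgue_integral_point_measure_finite)

end

text \<open>
  Here \<open>a\<close> and \<open>b\<close> are the masses of the atoms at \<open>-1\<close> and \<open>c\<close>, and the rest of the mass sits at
  \<open>0\<close>, where it does not contribute to moments of positive order. For even \<open>p\<close> and odd \<open>q\<close> with
  \<open>c = 2\<close> and \<open>t = 1\<close>, the equations \<open>a + b 2 ^ p = 1\<close> and \<open>- a + b 2 ^ q = 1\<close> have the solution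
  used below; \<open>p \<le> q\<close> gives \<open>a \<ge> 0\<close>, and \<open>a + b \<le> 1\<close> amounts to \<open>2 \<le> 2 * 2 ^ p\<close>.
\<close>

lemma three_point_moments:
  fixes p q :: nat
  assumes "0 < p" "p \<le> q" "\<not> (p < q \<and> odd p \<and> even q)"
  obtains a b c t :: real where "0 \<le> a" "0 < b" "b < 1" "a + b \<le> 1" "0 < c"
    "\<And>k. k \<in> {p, q} \<Longrightarrow> a * (-1) ^ k + b * c ^ k = t ^ k"
proof -
  consider "odd p" "odd q" | "even p" "even q" | "even p" "odd q"
    using assms by force
  then show thesis
  proof cases
    case 1
    then show thesis
      using that[of "1/2" "1/2" 1 0] by (fastforce elim: oddE)
  next
    case 2
    then show thesis
      using that[of "1/2" "1/2" 1 1] by fastforce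
  next
    case 3
    define P Q :: real where "P = 2 ^ p" and "Q = 2 ^ q"
    have P: "2 \<le> P" and PQ: "P \<le> Q"
      using assms power_increasing[of 1 p "2::real"] by (auto simp: P_def Q_def power_increasing)
    then have pos: "0 < Q + P" by linarith
    show thesis
    proof (rule that[of "(Q - P) / (Q + P)" "2 / (Q + P)" 2 1])
      fix k assume "k \<in> {p, q}"
      with 3 consider "k = p" "even p" | "k = q" "odd q"
        by auto
      then have numerator: "(Q - P) * (-1) ^ k + 2 * 2 ^ k = Q + P"
      proof cases
        case 1
        then have "(Q - P) * (-1) ^ k = Q - P" by auto
        moreover have "2 ^ k = P" using 1 by (simp add: P_def)
        ultimately show ?thesis by linarith
      next
        case 2
        then have "(Q - P) * (-1) ^ k = P - Q" by auto
        moreover have "2 ^ k = Q" using 2 by (simp add: Q_def)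
        ultimately show ?thesis by linarith
      qed
      have "(Q - P) / (Q + P) * (-1) ^ k + 2 / (Q + P) * 2 ^ k =
          ((Q - P) * (-1) ^ k + 2 * 2 ^ k) / (Q + P)"
        by (simp add: add_divide_distrib)
      with numerator pos show "(Q - P) / (Q + P) * (-1) ^ k + 2 / (Q + P) * 2 ^ k = 1 ^ k"
        by simp
    next
      show "(Q - P) / (Q + P) + 2 / (Q + P) \<le> 1"
        using P PQ by (simp flip: add_divide_distrib)
    qed (use P PQ pos in auto)
  qed
qed

theorem theorem1p9:
  fixes p q :: nat
  assumes "0 < p" and "0 < q" and "p \<le> q"
    and "\<not> (p < q \<and> odd p \<and> even q)"
  shows "\<exists>(H :: (nat \<Rightarrow> complex) chilbert) T F.
           complex_hilbert H \<and>
           T \<in> bounded_ops H \<and> selfadjoint H T \<and>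
           semispectral_measure H F \<and> compact (closed_support H F) \<and>
           \<not> spectral_measure H F \<and>
           (\<forall>k\<in>{p, q}. op_power H T k = op_integral H F (\<lambda>x. x ^ k))"
proof -
  obtain a b c t :: real where ab: "0 \<le> a" "0 < b" "b < 1" "a + b \<le> 1" and c: "0 < c"
    and moments: "\<And>k. k \<in> {p, q} \<Longrightarrow> a * (-1) ^ k + b * c ^ k = t ^ k"
    using assms(1,3,4) by (rule three_point_moments) blast
  define S w where "S = {-1, 0, c}" and "w = (\<lambda>x. if x = -1 then a else if x = c then b else 1 - a - b)"
  have S: "finite S" "\<And>x. x \<in> S \<Longrightarrow> 0 \<le> w x"
    using ab by (auto simp: S_def w_def)
  have sum_S: "(\<Sum>x\<in>S. w x * g x) = a * g (-1) + b * g c + (1 - a - b) * g 0" for g :: "real \<Rightarrow> real"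
    using c by (auto simp: S_def w_def)
  show ?thesis
  proof (rule semispectral_of_moments[where \<mu> = "atomic_measure S w" and K = S and D = "{c}" and t = t])
    show "prob_space (atomic_measure S w)"
      using sum_S[of "\<lambda>_. 1"] by (intro prob_space_atomic_measure S) auto
    show "compact S"
      using S(1) by (rule finite_imp_compact)
    then have "- S \<in> sets borel"
      by (simp add: borel_closed borel_comp compact_imp_closed)
    then show "measure (atomic_measure S w) (- S) = 0"
      by (simp add: measure_atomic_measure[OF S])
    have "measure (atomic_measure S w) {c} = b"
      using c by (simp add: measure_atomic_measure[OF S]) (simp add: S_def w_def)
    with ab show "0 < measure (atomic_measure S w) {c}" "measure (atomic_measure S w) {c} < 1"
      by auto
    fix k assume k: "k \<in> {p, q}"
    then have "(0::real) ^ k = 0"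
      using assms(1,2) by auto
    then show "(\<integral>x. x ^ k \<partial>atomic_measure S w) = t ^ k"
      using moments[OF k] by (simp add: integral_atomic_measure[OF S] sum_S)
  qed auto
qed

end
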